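(* Let $q$ be an indeterminate. For every integer $m\ge 1$, the following identity holds: $$\sum_{\substack{|\lambda|=2m+1\\ m_i(\lambda)\text{ even for every even } i}} \frac{1-q^{-\lambda_1'}}{q^{\frac12\sum_{i\ge1}(\lambda_i')^2-\frac{o(\lambda)}{2}}\ \prod_{i\ge1}(1/q^2;1/q^2)_{\lfloor m_i(\lambda)/2\rfloor}} = \frac{1}{q^m(1/q^2;1/q^2)_m}+\frac{1}{q^{m+1}}\sum_{i=0}^m\frac{(-1)^{i-1}}{q^{i(i+1)}\,(1/q^2;1/q^2)_{m-i}},$$ where the sum on the left is over all integer partitions $\lambda$ of $2m+1$ in which every even part size occurs with even multiplicity (possibly zero).
   Context: For a non-negative integer $n$, $(A;Q)_n=\prod_{k=0}^{n-1}(1-AQ^k)$, with $(A;Q)_0=1$. For an integer partition $\lambda$: $|\lambda|$ is its size; $m_i(\lambda)$ is the number of parts of $\lambda$ equal to $i$; $o(\lambda)$ is the number of odd parts of $\lambda$ (counted with multiplicity); $\lambda_i'=\sum_{j\ge i}m_j(\lambda)$, so $\lambda_1'$ is the number of parts of $\lambda$. *)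

theory Defs
  imports
    "HOL-Library.Multiset"
    "HOL-Computational_Algebra.Fraction_Field"
    "HOL-Computational_Algebra.Polynomial"
begin

definition qpoch :: "'a::comm_ring_1 \<Rightarrow> 'a \<Rightarrow> nat \<Rightarrow> 'a" where
  "qpoch A Q n = (\<Prod>k<n. 1 - A * Q ^ k)"

text \<open>An integer partition is the multiset of its (positive) parts, so that the multiplicity
  \<open>m\<^sub>i(\<mu>)\<close> is \<open>count \<mu> i\<close> and the size \<open>|\<mu>|\<close> is \<open>sum_mset \<mu>\<close>.\<close>

definition partitions_of :: "nat \<Rightarrow> nat multiset set" where
  "partitions_of n = {\<mu>. 0 \<notin># \<mu> \<and> sum_mset \<mu> = n}"

text \<open>The sum \<open>\<mu>'\<^sub>i = \<Sum>\<^bsub>j \<ge> i\<^esub> m\<^sub>j(\<mu>)\<close>, restricted to the finitely many \<open>j\<close>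
  with \<open>m\<^sub>j(\<mu>) \<noteq> 0\<close>.\<close>

definition conj_part :: "nat multiset \<Rightarrow> nat \<Rightarrow> nat" where
  "conj_part \<mu> i = (\<Sum>j | j \<in># \<mu> \<and> i \<le> j. count \<mu> j)"

definition odd_parts :: "nat multiset \<Rightarrow> nat" where
  "odd_parts \<mu> = size {#j \<in># \<mu>. odd j#}"

text \<open>Integer-valued exponent \<open>(\<Sum>\<^bsub>i \<ge> 1\<^esub> (\<mu>'\<^sub>i)\<^sup>2 - o(\<mu>)) / 2\<close>. Truncating the sum at
  \<open>|\<mu>|\<close> loses nothing (\<open>conj_part_eq_0\<close>), and the division is exact
  (\<open>two_times_expo\<close>).\<close>

definition expo :: "nat multiset \<Rightarrow> int" where
  "expo \<mu> = (int (\<Sum>i=1..sum_mset \<mu>. (conj_part \<mu> i)\<^sup>2) - int (odd_parts \<mu>)) div 2"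

lemma finite_partitions_of: "finite (partitions_of n)"
proof (rule finite_subset)
  show "partitions_of n \<subseteq> mset ` {xs. set xs \<subseteq> {..n} \<and> length xs \<le> n}"
  proof
    fix l assume l: "l \<in> partitions_of n"
    obtain xs where xs: "l = mset xs" by (metis ex_mset)
    have s: "sum_list xs = n" and p: "0 \<notin> set xs"
      using l by (auto simp: partitions_of_def xs sum_mset_sum_list)
    have "length ys \<le> sum_list ys" if "0 \<notin> set ys" for ys :: "nat list"
      using that by (induction ys) auto
    with s p have "length xs \<le> n" by blast
    moreover have "set xs \<subseteq> {..n}" using member_le_sum_list s by blast
    ultimately show "l \<in> mset ` {xs. set xs \<subseteq> {..n} \<and> length xs \<le> n}"
      using xs by blast
  qed
  show "finite (mset ` {xs. set xs \<subseteq> {..n} \<and> length xs \<le> n})"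
    by (intro finite_imageI finite_lists_length_le) simp
qed

lemma conj_part_eq_size: "conj_part \<mu> i = size {#j \<in># \<mu>. i \<le> j#}"
  by (auto simp: conj_part_def size_multiset_overloaded_eq intro!: sum.cong)

lemma part_le_size: "(j::nat) \<in># \<mu> \<Longrightarrow> j \<le> sum_mset \<mu>"
  by (metis le_add1 multi_member_split sum_mset.add_mset)

lemma conj_part_eq_0: "sum_mset \<mu> < i \<Longrightarrow> conj_part \<mu> i = 0"
  using part_le_size by (fastforce simp: conj_part_def)

lemma sum_conj_part:
  assumes "sum_mset \<mu> \<le> n" shows "(\<Sum>i=1..n. conj_part \<mu> i) = sum_mset \<mu>"
  using assms
proof (induction \<mu>)
  case empty
  then show ?case by (simp add: conj_part_eq_size)
next
  case (add x \<mu>)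
  have "(\<Sum>i=1..n. conj_part (add_mset x \<mu>) i)
      = (\<Sum>i=1..n. (if i \<le> x then 1 else 0) + conj_part \<mu> i)"
    by (intro sum.cong) (auto simp: conj_part_eq_size)
  also have "\<dots> = (\<Sum>i=1..n. if i \<le> x then 1 else 0) + sum_mset \<mu>"
    using add by (simp add: sum.distrib)
  also have "(\<Sum>i=1..n. if i \<le> x then 1 else (0::nat)) = card ({1..n} \<inter> {i. i \<le> x})"
    by (simp add: sum.If_cases)
  also have "{1..n} \<inter> {i. i \<le> x} = {1..x}" using add.prems by auto
  finally show ?case by simp
qed

lemma even_sum_mset_iff: "even (sum_mset \<mu>) \<longleftrightarrow> even (odd_parts \<mu>)"
  by (induction \<mu>) (auto simp: odd_parts_def)

lemma two_times_expo:
  "2 * expo \<mu> = int (\<Sum>i=1..sum_mset \<mu>. (conj_part \<mu> i)\<^sup>2) - int (odd_parts \<mu>)"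
proof -
  have "even (\<Sum>i\<in>A. (f i)\<^sup>2) \<longleftrightarrow> even (sum f A)" if "finite A"
    for f :: "nat \<Rightarrow> nat" and A
    using that by (induction A) auto
  then have "even (\<Sum>i=1..sum_mset \<mu>. (conj_part \<mu> i)\<^sup>2) \<longleftrightarrow> even (odd_parts \<mu>)"
    by (metis sum_conj_part even_sum_mset_iff order_refl finite_atLeastAtMost)
  then have "even (int (\<Sum>i=1..sum_mset \<mu>. (conj_part \<mu> i)\<^sup>2) - int (odd_parts \<mu>))"
    by (simp only: even_diff even_add even_of_nat)
  then show ?thesis unfolding expo_def by simp
qed

end

theory Submission
  imports Defs
begin

text \<open>
  Put \<open>t = 1/q\<close> and \<open>Q = t\<^sup>2\<close>, and write \<open>(Q)\<^sub>n\<close> for \<open>qpoch Q Q n\<close>. The exponent of \<open>t\<close> in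
  the summand is a sum over the columns \<open>\<mu>'\<^sub>i\<close> of the Ferrers diagram: each contributes
  \<open>\<mu>'\<^sub>i choose 2\<close>, and an even-indexed column contributes \<open>\<mu>'\<^sub>i\<close> more
  (\<open>expo_eq_col_exp\<close>). Deleting the first column lowers every part by one, so it exchanges
  this weight with its twin in which odd parts have even multiplicity and odd-indexed columns carry
  the extra term. (In odd characteristic these two families are the Jordan types of unipotent elements of
  orthogonal and of symplectic groups.) The weighted sums over the partitions of \<open>n\<close> with
  \<open>k\<close> parts, \<open>weight_sum False n k\<close> and \<open>weight_sum True n k\<close>, therefore determine each
  other recursively (\<open>weight_sum_recursion\<close>), and the recursion has solutions in product form,
  such as \<open>weight_sum False (2n+1) (2k+1) = t\<^sup>n Q\<^bsup>k*k\<^esup> [n,k] / (Q)\<^sub>k\<close> with the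
  Gaussian binomial \<open>[n,k]\<close>. That these satisfy the recursion comes down, in each of the four parity cases,
  to the \<open>q\<close>-Vandermonde identity (\<open>weight_sum_closed\<close>).

  A partition of \<open>2m+1\<close> whose even parts have even multiplicity has an odd number of parts, so the
  left-hand side of the theorem is \<open>\<Sum>\<^sub>j (1 - t\<^bsup>2j+1\<^esup>) weight_sum False (2m+1) (2j+1)\<close>, that is
  \<open>t\<^sup>m\<close> times \<open>\<Sum>\<^sub>j Q\<^bsup>j*j\<^esup> [m,j] / (Q)\<^sub>j\<close> minus \<open>t\<^bsup>m+1\<^esup>\<close> times
  \<open>\<Sum>\<^sub>j Q\<^bsup>j*(j+1)\<^esup> [m,j] / (Q)\<^sub>j\<close>. The first sum is \<open>1 / (Q)\<^sub>m\<close> (\<open>durfee_sum\<close>). The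
  second is the alternating sum of the theorem, because both satisfy one first-order recurrence in
  \<open>m\<close> (\<open>partial_theta_sum\<close>).
\<close>

section \<open>Gaussian binomials and finite sums\<close>

fun q_binom :: "'a::comm_ring_1 \<Rightarrow> nat \<Rightarrow> nat \<Rightarrow> 'a" where
  "q_binom Q n 0 = 1"
| "q_binom Q 0 (Suc k) = 0"
| "q_binom Q (Suc n) (Suc k) = q_binom Q n k + Q ^ Suc k * q_binom Q n (Suc k)"

text \<open>The coefficient of \<open>z\<^sup>n\<close> in \<open>z\<^sup>k / ((1 - z) (1 - zQ) \<dots> (1 - zQ\<^bsup>k-1\<^esup>))\<close>. At
  \<open>Q = 1\<close> it counts the compositions of \<open>n\<close> into \<open>k\<close> positive parts. It is the Gaussian binomial
  \<open>[n-1,k-1]\<close>, but with the right values at \<open>n = 0\<close> and \<open>k = 0\<close>, which truncated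
  subtraction would spoil.\<close>

fun q_compositions :: "'a::comm_ring_1 \<Rightarrow> nat \<Rightarrow> nat \<Rightarrow> 'a" where
  "q_compositions Q 0 0 = 1"
| "q_compositions Q 0 (Suc k) = 0"
| "q_compositions Q (Suc n) 0 = 0"
| "q_compositions Q (Suc n) (Suc k) = q_binom Q n k"

lemma qpoch_0 [simp]: "qpoch A Q 0 = 1"
  by (simp add: qpoch_def)

lemma qpoch_Suc: "qpoch A Q (Suc n) = qpoch A Q n * (1 - A * Q ^ n)"
  by (simp add: qpoch_def)

lemma q_binom_eq_0 [simp]: "n < k \<Longrightarrow> q_binom Q n k = 0"
  by (induction Q n k rule: q_binom.induct) auto

lemma q_compositions_eq_0 [simp]: "n < k \<Longrightarrow> q_compositions Q n k = 0"
  by (cases n; cases k) auto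

lemma q_binom_conv_q_compositions:
  "q_binom Q n k = q_compositions Q n k + Q ^ k * q_compositions Q n (Suc k)"
  by (cases n; cases k) auto

lemma q_binom_self [simp]: "q_binom Q n n = 1"
  by (induction n) auto

lemma q_compositions_self [simp]: "q_compositions Q n n = 1"
  by (cases n) auto

text \<open>The shift \<open>c\<close> makes the induction work: after Pascal's rule for \<open>[n+1,j]\<close>, the two
  resulting sums recombine by Pascal's rule for \<open>[k+1,j+c+1]\<close>, which raises both \<open>k\<close> and \<open>c\<close>.\<close>

lemma q_vandermonde:
  "(\<Sum>j\<le>n. Q ^ (j * (j + c)) * q_binom Q k (j + c) * q_binom Q n j) = q_binom Q (n + k) (n + c)"
proof (induction n arbitrary: k c)
  case 0
  then show ?case by simp
next
  case (Suc n)
  have "(\<Sum>j\<le>Suc n. Q ^ (j * (j + c)) * q_binom Q k (j + c) * q_binom Q (Suc n) j)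
      = q_binom Q k c +
        (\<Sum>j\<le>n. Q ^ (Suc j * (Suc j + c)) * q_binom Q k (Suc j + c) * q_binom Q n j) +
        (\<Sum>j\<le>n. Q ^ (Suc j * (Suc j + c) + Suc j) * q_binom Q k (Suc j + c) * q_binom Q n (Suc j))"
    by (simp add: sum.atMost_Suc_shift sum.distrib algebra_simps power_add
        del: sum.atMost_Suc)
  also have "\<dots> = (\<Sum>j\<le>n. Q ^ (Suc j * (Suc j + c)) * q_binom Q k (Suc j + c) * q_binom Q n j) +
        (\<Sum>j\<le>Suc n. Q ^ (j * (j + c) + j) * q_binom Q k (j + c) * q_binom Q n j)"
    by (simp add: sum.atMost_Suc_shift del: sum.atMost_Suc)
  also have "\<dots> = (\<Sum>j\<le>n. Q ^ (j * (j + Suc c)) * q_binom Q (Suc k) (j + Suc c) * q_binom Q n j)"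
    by (simp add: sum.distrib [symmetric] algebra_simps power_add)
  also have "\<dots> = q_binom Q (Suc n + k) (Suc n + c)"
    by (subst Suc.IH) simp
  finally show ?case .
qed

locale non_root_of_unity =
  fixes Q :: "'a::field"
  assumes power_neq_1: "0 < n \<Longrightarrow> Q ^ n \<noteq> 1"
begin

abbreviation P :: "nat \<Rightarrow> 'a" where
  "P n \<equiv> qpoch Q Q n"

lemma P_Suc: "P (Suc n) = P n * (1 - Q ^ Suc n)"
  by (simp add: qpoch_Suc)

lemma P_nz [simp]: "P n \<noteq> 0"
  using power_neq_1[of "Suc _"] by (induction n) (auto simp: P_Suc simp del: power_Suc)

lemma q_binom_product: "q_binom Q (n + k) k * (P n * P k) = P (n + k)"
proof (induction "n + k" arbitrary: n k)
  case 0
  then show ?case by simp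
next
  case (Suc N)
  show ?case
  proof (cases "n = 0 \<or> k = 0")
    case True
    then show ?thesis by auto
  next
    case False
    then obtain n' k' where [simp]: "n = Suc n'" "k = Suc k'"
      by (meson not0_implies_Suc)
    have 1: "q_binom Q (Suc (n' + k')) k' * (P (Suc n') * P k') = P (Suc (n' + k'))"
      using Suc.hyps(1)[of "Suc n'" k'] Suc.hyps(2) by simp
    have 2: "q_binom Q (Suc (n' + k')) (Suc k') * (P n' * P (Suc k')) = P (Suc (n' + k'))"
      using Suc.hyps(1)[of n' "Suc k'"] Suc.hyps(2) by simp
    have "q_binom Q (n + k) k * (P n * P k)
        = (1 - Q ^ Suc k') * (q_binom Q (Suc (n' + k')) k' * (P (Suc n') * P k'))
        + Q ^ Suc k' * (1 - Q ^ Suc n') *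
            (q_binom Q (Suc (n' + k')) (Suc k') * (P n' * P (Suc k')))"
      by (simp add: P_Suc algebra_simps del: qpoch_Suc)
    also have "\<dots> = P (Suc (n' + k')) * (1 - Q ^ Suc (Suc (n' + k')))"
      unfolding 1 2 by (simp add: algebra_simps power_add)
    finally show ?thesis by (simp add: P_Suc[of "Suc _"] del: power_Suc)
  qed
qed

lemma q_binom_conv_qpoch:
  assumes "k \<le> n"
  shows "q_binom Q n k = P n / (P k * P (n - k))"
  using q_binom_product[of "n - k" k] assms by (simp add: field_simps)

lemma q_binom_symmetric: "q_binom Q (n + k) n = q_binom Q (n + k) k"
  using q_binom_product[of n k] q_binom_product[of k n]
  by (metis P_nz add.commute mult.commute mult_cancel_right no_zero_divisors)

lemma q_vandermonde_unshifted:
  "(\<Sum>j\<le>k. Q ^ (j * j) * q_binom Q k j * q_binom Q n j) = q_binom Q (k + n) k"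
  using q_vandermonde[of Q 0 n k] q_binom_symmetric[of k n]
  by (simp add: mult_ac add_ac)

lemma q_compositions_convolution_Suc:
  "(\<Sum>j\<le>k. Q ^ (j * j) * q_binom Q k j * q_compositions Q n (Suc j))
    = q_compositions Q (k + n) (Suc k)"
  by (cases n) (use q_vandermonde_unshifted in auto)

lemma q_compositions_convolution:
  "(\<Sum>j\<le>k. Q ^ (j * (j - 1)) * q_binom Q k j * q_compositions Q n j) = q_compositions Q (k + n) k"
proof (cases n)
  case 0
  have "(\<Sum>j\<le>k. Q ^ (j * (j - 1)) * q_binom Q k j * q_compositions Q 0 j)
      = (\<Sum>j\<le>k. if j = 0 then 1 else 0)"
    by (intro sum.cong) (auto simp: gr0_conv_Suc)
  with 0 show ?thesis by simp
next
  case (Suc n')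
  show ?thesis
  proof (cases k)
    case 0
    with Suc show ?thesis by simp
  next
    case (Suc k')
    have "(\<Sum>j\<le>k. Q ^ (j * (j - 1)) * q_binom Q k j * q_compositions Q n j)
        = (\<Sum>j\<le>k'. Q ^ (j * (j + 1)) * q_binom Q k (j + 1) * q_binom Q n' j)"
      by (simp add: Suc \<open>n = Suc n'\<close> sum.atMost_Suc_shift mult_ac add_ac
          del: sum.atMost_Suc q_binom.simps)
    also have "\<dots> = (\<Sum>j\<le>n'. Q ^ (j * (j + 1)) * q_binom Q k (j + 1) * q_binom Q n' j)"
      by (intro sum.mono_neutral_cong) (auto simp: Suc not_le)
    also have "\<dots> = q_binom Q (n' + k) (n' + 1)"
      by (rule q_vandermonde)
    also have "\<dots> = q_binom Q (n' + k) k'"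
      using q_binom_symmetric[of "Suc n'" k'] Suc by simp
    finally show ?thesis by (simp add: Suc \<open>n = Suc n'\<close> add_ac)
  qed
qed

text \<open>For \<open>c = 0\<close> this is the classification by Durfee square of partitions with parts at most
  \<open>n\<close>. As in \<open>q_vandermonde\<close>, the shift \<open>c\<close> absorbs Pascal's rule: raising \<open>n\<close> by one has the
  same effect as raising \<open>c\<close> by one.\<close>

lemma durfee_sum:
  "(\<Sum>j\<le>n. Q ^ (j * (j + c)) * q_binom Q n j / P (j + c)) = 1 / P (n + c)"
proof (induction n arbitrary: c)
  case 0
  then show ?case by simp
next
  case (Suc n)
  have "(\<Sum>j\<le>Suc n. Q ^ (j * (j + c)) * q_binom Q (Suc n) j / P (j + c))
      = 1 / P c +
        (\<Sum>j\<le>n. Q ^ (Suc j * (Suc j + c)) * q_binom Q n j / P (Suc j + c)) +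
        (\<Sum>j\<le>n. Q ^ (Suc j * (Suc j + c) + Suc j) * q_binom Q n (Suc j) / P (Suc j + c))"
    by (simp add: sum.atMost_Suc_shift sum.distrib algebra_simps power_add add_divide_distrib
        del: sum.atMost_Suc)
  also have "\<dots> = (\<Sum>j\<le>n. Q ^ (Suc j * (Suc j + c)) * q_binom Q n j / P (Suc j + c)) +
        (\<Sum>j\<le>Suc n. Q ^ (j * (j + c) + j) * q_binom Q n j / P (j + c))"
    by (simp add: sum.atMost_Suc_shift del: sum.atMost_Suc)
  also have "\<dots> = (\<Sum>j\<le>n. Q ^ (Suc j * (Suc j + c)) * q_binom Q n j / P (Suc j + c) +
        Q ^ (j * (j + c) + j) * q_binom Q n j / P (j + c))"
    by (simp add: sum.distrib)
  also have "\<dots> = (\<Sum>j\<le>n. Q ^ (j * (j + Suc c)) * q_binom Q n j / P (j + Suc c))"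
  proof (rule sum.cong[OF refl])
    fix j
    have nz: "1 - Q ^ Suc (j + c) \<noteq> 0"
      using power_neq_1[of "Suc (j + c)"] by (simp del: power_Suc)
    have "Q ^ (j * (j + c) + j) * q_binom Q n j / P (j + c)
        = Q ^ (j * (j + c) + j) * q_binom Q n j * (1 - Q ^ Suc (j + c)) / P (Suc (j + c))"
      unfolding P_Suc using nz by (simp del: power_Suc)
    then show "Q ^ (Suc j * (Suc j + c)) * q_binom Q n j / P (Suc j + c) +
        Q ^ (j * (j + c) + j) * q_binom Q n j / P (j + c)
        = Q ^ (j * (j + Suc c)) * q_binom Q n j / P (j + Suc c)"
      by (simp add: add_divide_distrib[symmetric] algebra_simps power_add)
  qed
  also have "\<dots> = 1 / P (Suc n + c)"
    by (subst Suc.IH) simp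
  finally show ?case .
qed

text \<open>Both sides satisfy \<open>(1 - Q\<^bsup>n+1\<^esup>) f(n) = f(n+1) - Q\<^bsup>n+1\<^esup> / (Q)\<^bsub>n+1\<^esub>\<close>. On the left this
  follows from \<open>(1 - Q\<^bsup>n+1\<^esup>) [n,j] = (1 - Q\<^bsup>n+1-j\<^esup>) [n+1,j]\<close>: the subtracted part is a
  multiple of the sum in \<open>durfee_sum\<close>. On the right it reflects the functional equation
  \<open>\<theta>(z) = 1 - zQ \<theta>(zQ)\<close> of the partial theta series with coefficients
  \<open>(-1)\<^sup>i Q\<^bsup>i(i+1)/2\<^esup>\<close>.\<close>

lemma partial_theta_sum:
  "(\<Sum>j\<le>n. Q ^ (j * (j + 1)) * q_binom Q n j / P j)
    = (\<Sum>i\<le>n. (- 1) ^ i * Q ^ (i * (i + 1) div 2) / P (n - i))"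
proof (induction n)
  case 0
  then show ?case by simp
next
  case (Suc n)
  let ?s = "\<lambda>i. (- 1) ^ i * Q ^ (i * (i + 1) div 2)"
  let ?L = "\<lambda>n. \<Sum>j\<le>n. Q ^ (j * (j + 1)) * q_binom Q n j / P j"
  let ?R = "\<lambda>n. \<Sum>i\<le>n. ?s i / P (n - i)"
  have 1: "(1 - Q ^ Suc n) * ?L n = ?L (Suc n) - Q ^ Suc n / P (Suc n)"
  proof -
    have abs: "(1 - Q ^ Suc n) * q_binom Q n j = (1 - Q ^ (Suc n - j)) * q_binom Q (Suc n) j"
      if "j \<le> n" for j
      using that power_neq_1[of "Suc (n - j)"]
      by (simp add: q_binom_conv_qpoch Suc_diff_le P_Suc del: power_Suc q_binom.simps)
    have "(1 - Q ^ Suc n) * ?L n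
        = (\<Sum>j\<le>n. Q ^ (j * (j + 1)) * ((1 - Q ^ Suc n) * q_binom Q n j) / P j)"
      by (simp add: sum_distrib_left mult_ac)
    also have "\<dots> = (\<Sum>j\<le>n. Q ^ (j * (j + 1)) * ((1 - Q ^ (Suc n - j)) * q_binom Q (Suc n) j) / P j)"
      by (intro sum.cong) (use abs in auto)
    also have "\<dots> = (\<Sum>j\<le>Suc n. Q ^ (j * (j + 1)) * ((1 - Q ^ (Suc n - j)) * q_binom Q (Suc n) j) / P j)"
      by simp
    also have "\<dots> = (\<Sum>j\<le>Suc n. Q ^ (j * (j + 1)) * q_binom Q (Suc n) j / P j
        - Q ^ Suc n * (Q ^ (j * j) * q_binom Q (Suc n) j / P j))"
    proof (rule sum.cong[OF refl])
      fix j assume "j \<in> {..Suc n}"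
      then have "Q ^ (j * (j + 1)) * Q ^ (Suc n - j) = Q ^ Suc n * Q ^ (j * j)"
        by (simp add: power_add[symmetric] add.commute)
      then show "Q ^ (j * (j + 1)) * ((1 - Q ^ (Suc n - j)) * q_binom Q (Suc n) j) / P j
        = Q ^ (j * (j + 1)) * q_binom Q (Suc n) j / P j
        - Q ^ Suc n * (Q ^ (j * j) * q_binom Q (Suc n) j / P j)"
        by (simp add: right_diff_distrib left_diff_distrib diff_divide_distrib
             del: power_Suc q_binom.simps flip: mult.assoc)
    qed
    also have "\<dots> = ?L (Suc n) - Q ^ Suc n *
        (\<Sum>j\<le>Suc n. Q ^ (j * j) * q_binom Q (Suc n) j / P j)"
      by (simp only: sum_subtractf sum_distrib_left)
    finally show ?thesis unfolding durfee_sum[where c = 0, unfolded add_0_right] by simp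
  qed
  have 2: "(1 - Q ^ Suc n) * ?R n = ?R (Suc n) - Q ^ Suc n / P (Suc n)"
  proof -
    have "?R n = (\<Sum>i\<le>Suc n. ?s i * (1 - Q ^ (Suc n - i)) / P (Suc n - i))"
      using power_neq_1[of "Suc n - _"]
      by (simp del: power_Suc add: Suc_diff_le P_Suc)
    also have "\<dots> = ?R (Suc n) - (\<Sum>i\<le>Suc n. ?s i * Q ^ (Suc n - i) / P (Suc n - i))"
      by (simp only: right_diff_distrib diff_divide_distrib sum_subtractf mult_1_right)
    also have "(\<Sum>i\<le>Suc n. ?s i * Q ^ (Suc n - i) / P (Suc n - i))
        = Q ^ Suc n / P (Suc n) + (\<Sum>i\<le>n. ?s (Suc i) * Q ^ (n - i) / P (n - i))"
      by (simp add: sum.atMost_Suc_shift del: sum.atMost_Suc power_Suc)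
    also have "(\<Sum>i\<le>n. ?s (Suc i) * Q ^ (n - i) / P (n - i)) = - (Q ^ Suc n) * ?R n"
      unfolding sum_distrib_left
    proof (rule sum.cong[OF refl])
      fix i assume "i \<in> {..n}"
      moreover have "Suc i * (Suc i + 1) div 2 = i * (i + 1) div 2 + Suc i"
        by simp
      ultimately have "Suc i * (Suc i + 1) div 2 + (n - i) = Suc n + i * (i + 1) div 2"
        by (simp only: atMost_iff)
      then have "Q ^ (Suc i * (Suc i + 1) div 2) * Q ^ (n - i) = Q ^ Suc n * Q ^ (i * (i + 1) div 2)"
        by (simp only: power_add[symmetric])
      then show "?s (Suc i) * Q ^ (n - i) / P (n - i) = - (Q ^ Suc n) * (?s i / P (n - i))"
        by (simp only: mult.assoc) (simp del: mult_Suc mult_Suc_right)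
    qed
    finally show ?thesis by (simp add: algebra_simps)
  qed
  have "c * x = u - d \<Longrightarrow> c * y = v - d \<Longrightarrow> x = y \<Longrightarrow> u = v" for c d u v x y :: 'a
    by simp
  from this[OF 1 2 Suc.IH] show ?case .
qed

end

section \<open>Removing the first column of a partition\<close>

text \<open>Both parity conditions at once, since removing a column exchanges them: \<open>e = False\<close> asks even
  parts to have even multiplicity (orthogonal type), \<open>e = True\<close> asks this of odd parts
  (symplectic type).\<close>

definition orthosymplectic :: "bool \<Rightarrow> nat \<Rightarrow> nat \<Rightarrow> nat multiset set" where
  "orthosymplectic e n k =
    {\<mu> \<in> partitions_of n. size \<mu> = k \<and> (\<forall>i. odd i = e \<longrightarrow> even (count \<mu> i))}"

definition add_column :: "nat \<Rightarrow> nat multiset \<Rightarrow> nat multiset" where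
  "add_column k \<mu> = image_mset Suc \<mu> + replicate_mset (k - size \<mu>) 1"

lemma count_image_Suc [simp]:
  "count (image_mset Suc \<mu>) 0 = 0" "count (image_mset Suc \<mu>) (Suc i) = count \<mu> i"
  by (induction \<mu>) auto

lemma count_add_column:
  "count (add_column k \<mu>) i =
    (if i = 0 then 0 else if i = 1 then count \<mu> 0 + (k - size \<mu>) else count \<mu> (i - 1))"
  by (cases i) (auto simp: add_column_def)

lemma size_add_column: "size \<mu> \<le> k \<Longrightarrow> size (add_column k \<mu>) = k"
  by (simp add: add_column_def)

lemma sum_mset_image_Suc: "sum_mset (image_mset Suc \<mu>) = sum_mset \<mu> + size \<mu>"
  by (induction \<mu>) auto

lemma sum_add_column: "size \<mu> \<le> k \<Longrightarrow> sum_mset (add_column k \<mu>) = sum_mset \<mu> + k"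
  by (simp add: add_column_def sum_mset_image_Suc)

lemma ex_add_column:
  assumes "0 \<notin># \<nu>"
  shows "\<exists>\<mu>. 0 \<notin># \<mu> \<and> size \<mu> \<le> size \<nu> \<and> \<nu> = add_column (size \<nu>) \<mu>"
  using assms
proof (induction \<nu>)
  case empty
  then show ?case by (auto simp: add_column_def)
next
  case (add x \<nu>)
  then obtain \<mu> where \<mu>: "0 \<notin># \<mu>" "size \<mu> \<le> size \<nu>" "\<nu> = add_column (size \<nu>) \<mu>"
    by auto
  from add.prems obtain y where y: "x = Suc y"
    by (cases x) auto
  show ?case
  proof (cases "y = 0")
    case True
    have "add_mset x \<nu> = add_column (size (add_mset x \<nu>)) \<mu>"
      by (subst \<mu>(3)) (use \<mu>(2) True y in \<open>simp add: add_column_def Suc_diff_le\<close>)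
    with \<mu>(1) le_SucI[OF \<mu>(2)] show ?thesis unfolding size_add_mset by blast
  next
    case False
    have "add_mset x \<nu> = add_column (size (add_mset x \<nu>)) (add_mset y \<mu>)"
      by (subst \<mu>(3)) (use \<mu>(2) y in \<open>simp add: add_column_def\<close>)
    moreover have "0 \<notin># add_mset y \<mu>" "size (add_mset y \<mu>) \<le> size (add_mset x \<nu>)"
      using \<mu>(1,2) False by auto
    ultimately show ?thesis by blast
  qed
qed

lemma finite_orthosymplectic [simp]: "finite (orthosymplectic e n k)"
  by (rule finite_subset[OF _ finite_partitions_of[of n]]) (auto simp: orthosymplectic_def)

text \<open>Part \<open>i\<close> of the smaller partition becomes part \<open>i + 1\<close>, so its parity condition flips. The
  \<open>k - j\<close> new parts are equal to 1, and the condition for \<open>e\<close> constrains their number only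
  if \<open>e\<close> concerns odd parts.\<close>

lemma bij_betw_add_column:
  "bij_betw (add_column k)
     (\<Union>j\<in>{j. j \<le> k \<and> (e \<longrightarrow> even (k - j))}. orthosymplectic (\<not> e) n j)
     (orthosymplectic e (n + k) k)"
  (is "bij_betw _ ?A ?B")
proof (rule bij_betw_imageI)
  show "inj_on (add_column k) ?A"
  proof (rule inj_onI)
    fix \<mu> \<nu> assume *: "\<mu> \<in> ?A" "\<nu> \<in> ?A" "add_column k \<mu> = add_column k \<nu>"
    show "\<mu> = \<nu>"
    proof (rule multiset_eqI)
      fix i
      show "count \<mu> i = count \<nu> i"
      proof (cases "i = 0")
        case True
        with * show ?thesis
          by (auto simp: orthosymplectic_def partitions_of_def not_in_iff)
      next
        case False
        with arg_cong[OF *(3), of "\<lambda>\<mu>. count \<mu> (Suc i)"] show ?thesis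
          by (simp add: count_add_column)
      qed
    qed
  qed
next
  have parity: "(\<forall>i. odd i = e \<longrightarrow> even (count (add_column k \<mu>) i)) \<longleftrightarrow>
      (e \<longrightarrow> even (k - size \<mu>)) \<and> (\<forall>i. odd i = (\<not> e) \<longrightarrow> even (count \<mu> i))"
    if "0 \<notin># \<mu>" for \<mu>
  proof -
    have c0: "count \<mu> 0 = 0" using that by (simp add: not_in_iff)
    have "(\<forall>i. odd i = e \<longrightarrow> even (count (add_column k \<mu>) i)) \<longleftrightarrow>
        (\<forall>i. odd (Suc i) = e \<longrightarrow> even (count (add_column k \<mu>) (Suc i)))"
      by (metis count_add_column even_zero not0_implies_Suc)
    also have "\<dots> \<longleftrightarrow> (odd (Suc 0) = e \<longrightarrow> even (count (add_column k \<mu>) (Suc 0))) \<and>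
        (\<forall>i>0. odd (Suc i) = e \<longrightarrow> even (count (add_column k \<mu>) (Suc i)))"
      by (metis gr0I)
    also have "\<dots> \<longleftrightarrow> (e \<longrightarrow> even (k - size \<mu>)) \<and> (\<forall>i>0. odd i = (\<not> e) \<longrightarrow> even (count \<mu> i))"
      by (auto simp: count_add_column c0)
    also have "(\<forall>i>0. odd i = (\<not> e) \<longrightarrow> even (count \<mu> i)) \<longleftrightarrow>
        (\<forall>i. odd i = (\<not> e) \<longrightarrow> even (count \<mu> i))"
      using c0 by (metis even_zero gr0I)
    finally show ?thesis .
  qed
  have no0: "0 \<notin># add_column k \<mu>" for \<mu>
    by (auto simp: add_column_def)
  show "add_column k ` ?A = ?B"
  proof (intro equalityI subsetI)
    fix \<nu> assume "\<nu> \<in> add_column k ` ?A"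
    then obtain \<mu> where \<mu>: "\<mu> \<in> ?A" "\<nu> = add_column k \<mu>" by blast
    then show "\<nu> \<in> ?B"
      using parity[of \<mu>] no0
      by (auto simp: orthosymplectic_def partitions_of_def size_add_column sum_add_column)
  next
    fix \<nu> assume \<nu>: "\<nu> \<in> ?B"
    then obtain \<mu> where \<mu>: "0 \<notin># \<mu>" "size \<mu> \<le> k" "\<nu> = add_column k \<mu>"
      using ex_add_column[of \<nu>] by (auto simp: orthosymplectic_def partitions_of_def)
    have "\<mu> \<in> ?A"
      using \<nu> \<mu> parity[of \<mu>]
      by (auto simp: orthosymplectic_def partitions_of_def size_add_column sum_add_column)
    then show "\<nu> \<in> add_column k ` ?A" using \<mu>(3) by blast
  qed
qed

definition col_exp :: "bool \<Rightarrow> nat multiset \<Rightarrow> nat" where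
  "col_exp e \<mu> = (\<Sum>i=1..sum_mset \<mu>.
     (conj_part \<mu> i choose 2) + (if odd i = e then conj_part \<mu> i else 0))"

lemma col_exp_bound:
  assumes "sum_mset \<mu> \<le> N"
  shows "col_exp e \<mu> = (\<Sum>i=1..N. (conj_part \<mu> i choose 2) + (if odd i = e then conj_part \<mu> i else 0))"
  unfolding col_exp_def using assms
  by (intro sum.mono_neutral_left) (auto simp: conj_part_eq_0)

lemma conj_part_1: "0 \<notin># \<mu> \<Longrightarrow> conj_part \<mu> 1 = size \<mu>"
  unfolding conj_part_eq_size
  by (metis (no_types, lifting) One_nat_def filter_mset_eq_conv Suc_leI gr0I multiset_filter_subset
      filter_mset_cong filter_mset_True)

lemma conj_part_add_column:
  assumes "0 < i" shows "conj_part (add_column k \<mu>) (Suc i) = conj_part \<mu> i"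
  using assms by (simp add: conj_part_eq_size add_column_def filter_mset_image_mset)

lemma col_exp_add_column:
  assumes "0 \<notin># \<mu>" "size \<mu> \<le> k" "0 < k"
  shows "col_exp e (add_column k \<mu>) = (k choose 2) + (if e then k else 0) + col_exp (\<not> e) \<mu>"
proof -
  define g where "g i = (conj_part (add_column k \<mu>) i choose 2) +
    (if odd i = e then conj_part (add_column k \<mu>) i else 0)" for i
  define N where "N = sum_mset \<mu> + (k - 1)"
  have sum: "sum_mset (add_column k \<mu>) = Suc N"
    using assms by (simp add: sum_add_column N_def)
  have "col_exp e (add_column k \<mu>) = (\<Sum>i=1..Suc N. g i)"
    by (simp only: col_exp_def sum g_def)
  also have "\<dots> = g 1 + (\<Sum>i=1..N. g (Suc i))"
    by (simp add: sum.atLeast_Suc_atMost sum.atLeast_Suc_atMost_Suc_shift del: sum.cl_ivl_Suc)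
  also have "g 1 = (k choose 2) + (if e then k else 0)"
  proof -
    have "conj_part (add_column k \<mu>) 1 = k"
      using conj_part_1[of "add_column k \<mu>"] size_add_column[of \<mu> k] assms
      by (auto simp: add_column_def)
    then show ?thesis by (simp add: g_def)
  qed
  also have "(\<Sum>i=1..N. g (Suc i)) = col_exp (\<not> e) \<mu>"
    by (subst col_exp_bound[of \<mu> N])
       (auto simp: N_def g_def conj_part_add_column intro!: sum.cong)
  finally show ?thesis .
qed

lemma prod_multiplicities_bound:
  fixes \<mu> :: "nat multiset"
  assumes "sum_mset \<mu> \<le> N" "f 0 = (1::'a::comm_monoid_mult)"
  shows "(\<Prod>i=1..sum_mset \<mu>. f (count \<mu> i div 2)) = (\<Prod>i=1..N. f (count \<mu> i div 2))"
proof (rule prod.mono_neutral_left)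
  show "\<forall>i\<in>{1..N} - {1..sum_mset \<mu>}. f (count \<mu> i div 2) = 1"
  proof
    fix i assume "i \<in> {1..N} - {1..sum_mset \<mu>}"
    then have "i \<notin># \<mu>" using part_le_size[of i \<mu>] by auto
    then show "f (count \<mu> i div 2) = 1" using assms by (simp add: not_in_iff)
  qed
qed (use assms in auto)

lemma prod_multiplicities_add_column:
  assumes "0 \<notin># \<mu>" "size \<mu> \<le> k" "0 < k" "f 0 = (1::'a::comm_monoid_mult)"
  shows "(\<Prod>i=1..sum_mset (add_column k \<mu>). f (count (add_column k \<mu>) i div 2))
    = f ((k - size \<mu>) div 2) * (\<Prod>i=1..sum_mset \<mu>. f (count \<mu> i div 2))"
proof -
  define N where "N = sum_mset \<mu> + (k - 1)"
  have sum: "sum_mset (add_column k \<mu>) = Suc N"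
    using assms by (simp add: sum_add_column N_def)
  have "(\<Prod>i=1..Suc N. f (count (add_column k \<mu>) i div 2))
    = f (count (add_column k \<mu>) 1 div 2) * (\<Prod>i=1..N. f (count (add_column k \<mu>) (Suc i) div 2))"
    by (simp add: prod.atLeast_Suc_atMost prod.atLeast_Suc_atMost_Suc_shift del: prod.cl_ivl_Suc)
  also have "(\<Prod>i=1..N. f (count (add_column k \<mu>) (Suc i) div 2))
      = (\<Prod>i=1..sum_mset \<mu>. f (count \<mu> i div 2))"
    by (subst prod_multiplicities_bound[of \<mu> N])
       (auto simp: assms N_def count_add_column intro!: prod.cong)
  also have "count (add_column k \<mu>) 1 = k - size \<mu>"
    using assms by (simp add: count_add_column not_in_iff)
  finally show ?thesis by (simp only: sum)
qed

text \<open>Each part \<open>x\<close> occupies one cell in each of the columns \<open>1, \<dots>, x\<close>, and the alternating sum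
  \<open>1 - 1 + 1 - \<dots>\<close> with \<open>x\<close> terms is 1 exactly if \<open>x\<close> is odd.\<close>

lemma odd_parts_conv_conj_part:
  assumes "sum_mset \<mu> \<le> N"
  shows "int (odd_parts \<mu>) = (\<Sum>i=1..N. if odd i then int (conj_part \<mu> i) else - int (conj_part \<mu> i))"
  using assms
proof (induction \<mu>)
  case empty
  then show ?case by (simp add: odd_parts_def conj_part_eq_size cong: if_cong)
next
  case (add x \<mu>)
  have alt: "(\<Sum>i=1..n. if odd i then 1 else - 1 :: int) = (if odd n then 1 else 0)" for n :: nat
    by (induction n) auto
  have "(\<Sum>i=1..N. if odd i then int (conj_part (add_mset x \<mu>) i)
          else - int (conj_part (add_mset x \<mu>) i))
      = (\<Sum>i=1..N. (if i \<le> x then if odd i then 1 else - 1 else 0) +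
          (if odd i then int (conj_part \<mu> i) else - int (conj_part \<mu> i)))"
    by (intro sum.cong) (auto simp: conj_part_eq_size)
  also have "\<dots> = (\<Sum>i=1..N. if i \<le> x then if odd i then 1 else - 1 else 0) + int (odd_parts \<mu>)"
    using add by (simp add: sum.distrib)
  also have "(\<Sum>i=1..N. if i \<le> x then if odd i then 1 else - 1 else (0::int))
      = (\<Sum>i=1..x. if odd i then 1 else - 1)"
    using add.prems by (intro sum.mono_neutral_cong_right) auto
  finally show ?case unfolding alt by (simp add: odd_parts_def)
qed

lemma expo_eq_col_exp: "expo \<mu> = int (col_exp False \<mu>)"
proof -
  have tri: "2 * int (a choose 2) = (int a)\<^sup>2 - int a" for a
    by (induction a) (auto simp: numeral_2_eq_2 algebra_simps)
  have "2 * int (col_exp False \<mu>)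
      = (\<Sum>i=1..sum_mset \<mu>. (int (conj_part \<mu> i))\<^sup>2
          - (if odd i then int (conj_part \<mu> i) else - int (conj_part \<mu> i)))"
    unfolding col_exp_def of_nat_sum sum_distrib_left
    by (intro sum.cong) (auto simp: tri ring_distribs)
  also have "\<dots> = 2 * expo \<mu>"
    unfolding two_times_expo by (subst odd_parts_conv_conj_part[OF order_refl]) (simp add: sum_subtractf)
  finally show ?thesis by simp
qed

lemma odd_size_orthogonal:
  fixes \<mu> :: "nat multiset"
  assumes "odd (sum_mset \<mu>)" "\<forall>i. even i \<longrightarrow> even (count \<mu> i)"
  shows "odd (size \<mu>)"
proof -
  have "even (size {#j \<in># \<mu>. even j#})"
    unfolding size_multiset_overloaded_eq by (rule dvd_sum) (use assms(2) in auto)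
  moreover have "size \<mu> = size {#j \<in># \<mu>. even j#} + odd_parts \<mu>"
    unfolding odd_parts_def by (metis multiset_partition size_union)
  ultimately show ?thesis using assms(1) even_sum_mset_iff[of \<mu>] by simp
qed

lemma sum_parity_classes:
  fixes f :: "nat \<Rightarrow> 'a::comm_monoid_add"
  shows "(\<Sum>j | j \<le> 2 * k \<and> (True \<longrightarrow> even (2 * k - j)). f j) = (\<Sum>i\<le>k. f (2 * i))"
    and "(\<Sum>j | j \<le> 2 * k + 1 \<and> (True \<longrightarrow> even (2 * k + 1 - j)). f j) = (\<Sum>i\<le>k. f (2 * i + 1))"
    and "(\<Sum>j | j \<le> 2 * k \<and> (False \<longrightarrow> even (2 * k - j)). f j)
      = (\<Sum>i\<le>k. f (2 * i)) + (\<Sum>i<k. f (2 * i + 1))"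
    and "(\<Sum>j | j \<le> 2 * k + 1 \<and> (False \<longrightarrow> even (2 * k + 1 - j)). f j)
      = (\<Sum>i\<le>k. f (2 * i)) + (\<Sum>i\<le>k. f (2 * i + 1))"
proof -
  show "(\<Sum>j | j \<le> 2 * k \<and> (True \<longrightarrow> even (2 * k - j)). f j) = (\<Sum>i\<le>k. f (2 * i))"
    by (rule sum.reindex_bij_witness[of _ "\<lambda>i. 2 * i" "\<lambda>j. j div 2"]) auto
  show "(\<Sum>j | j \<le> 2 * k + 1 \<and> (True \<longrightarrow> even (2 * k + 1 - j)). f j) = (\<Sum>i\<le>k. f (2 * i + 1))"
    by (rule sum.reindex_bij_witness[of _ "\<lambda>i. 2 * i + 1" "\<lambda>j. j div 2"]) auto
  have 1: "sum f {..2 * k} = (\<Sum>i\<le>k. f (2 * i)) + (\<Sum>i<k. f (2 * i + 1))" for k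
    by (induction k) (auto simp: ac_simps)
  then show "(\<Sum>j | j \<le> 2 * k \<and> (False \<longrightarrow> even (2 * k - j)). f j)
      = (\<Sum>i\<le>k. f (2 * i)) + (\<Sum>i<k. f (2 * i + 1))"
    by (simp add: atMost_def)
  show "(\<Sum>j | j \<le> 2 * k + 1 \<and> (False \<longrightarrow> even (2 * k + 1 - j)). f j)
      = (\<Sum>i\<le>k. f (2 * i)) + (\<Sum>i\<le>k. f (2 * i + 1))"
    using 1[of k] by (simp add: ac_simps lessThan_Suc_atMost[symmetric] flip: atMost_def)
qed

lemma size_orthosymplectic: "\<mu> \<in> orthosymplectic e n k \<Longrightarrow> size \<mu> = k"
  by (simp add: orthosymplectic_def)

lemma size_le_sum_mset: "0 \<notin># \<mu> \<Longrightarrow> size \<mu> \<le> sum_mset \<mu>"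
  by (induction \<mu>) (auto simp: Suc_le_eq)

section \<open>The weighted sums with a given number of parts\<close>

locale column_weights = non_root_of_unity +
  fixes t :: 'a
  assumes Q_eq: "Q = t\<^sup>2"
begin

definition weight :: "bool \<Rightarrow> nat multiset \<Rightarrow> 'a" where
  "weight e \<mu> = t ^ col_exp e \<mu> / (\<Prod>i=1..sum_mset \<mu>. P (count \<mu> i div 2))"

definition weight_sum :: "bool \<Rightarrow> nat \<Rightarrow> nat \<Rightarrow> 'a" where
  "weight_sum e n k = (\<Sum>\<mu>\<in>orthosymplectic e n k. weight e \<mu>)"

lemma weight_sum_eq_0:
  assumes "n < k"
  shows "weight_sum e n k = 0"
proof -
  have "orthosymplectic e n k = {}"
    using size_le_sum_mset assms by (fastforce simp: orthosymplectic_def partitions_of_def)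
  then show ?thesis by (simp add: weight_sum_def)
qed

lemma weight_sum_0: "weight_sum e n 0 = (if n = 0 then 1 else 0)"
proof -
  have "orthosymplectic e n 0 = (if n = 0 then {{#}} else {})"
    by (auto simp: orthosymplectic_def partitions_of_def)
  then show ?thesis by (simp add: weight_sum_def weight_def col_exp_def)
qed

lemma weight_add_column:
  assumes "0 \<notin># \<mu>" "size \<mu> \<le> k" "0 < k"
  shows "weight e (add_column k \<mu>) =
    t ^ ((k choose 2) + (if e then k else 0)) * (weight (\<not> e) \<mu> / P ((k - size \<mu>) div 2))"
  unfolding weight_def col_exp_add_column[OF assms]
    prod_multiplicities_add_column[where f = P, OF assms qpoch_0]
  by (simp add: power_add)

text \<open>A sum over the length \<open>j\<close> of the second column. The first column has length \<open>k\<close>, and it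
  leaves \<open>k - j\<close> parts equal to 1.\<close>

lemma weight_sum_recursion:
  assumes "0 < k"
  shows "weight_sum e (n + k) k = t ^ ((k choose 2) + (if e then k else 0)) *
    (\<Sum>j | j \<le> k \<and> (e \<longrightarrow> even (k - j)). weight_sum (\<not> e) n j / P ((k - j) div 2))"
proof -
  let ?J = "{j. j \<le> k \<and> (e \<longrightarrow> even (k - j))}"
  let ?c = "t ^ ((k choose 2) + (if e then k else 0))"
  have "weight_sum e (n + k) k
      = (\<Sum>\<mu>\<in>(\<Union>j\<in>?J. orthosymplectic (\<not> e) n j). weight e (add_column k \<mu>))"
    unfolding weight_sum_def by (rule sum.reindex_bij_betw[OF bij_betw_add_column, symmetric])
  also have "\<dots> = (\<Sum>j\<in>?J. \<Sum>\<mu>\<in>orthosymplectic (\<not> e) n j. weight e (add_column k \<mu>))"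
    by (rule sum.UNION_disjoint) (simp_all, auto dest!: size_orthosymplectic)
  also have "\<dots> = (\<Sum>j\<in>?J. ?c * (weight_sum (\<not> e) n j / P ((k - j) div 2)))"
    unfolding weight_sum_def sum_divide_distrib sum_distrib_left
    by (intro sum.cong refl)
       (auto simp: orthosymplectic_def partitions_of_def assms weight_add_column)
  finally show ?thesis by (simp add: sum_distrib_left)
qed

lemma t_power:
  "a = b + 2 * c \<Longrightarrow> t ^ a = t ^ b * Q ^ c"
  by (simp add: Q_eq power_add power_mult)

lemma choose_two_even: "2 * k choose 2 = k + 2 * (k * (k - 1))"
  by (cases k) (auto simp: choose_two algebra_simps)

lemma choose_two_odd: "2 * k + 1 choose 2 = k + 2 * (k * k)"
  by (auto simp: choose_two algebra_simps)

lemma weight_sum_True_even_step: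
  assumes "\<And>j. weight_sum False (2 * n) (2 * j) = t ^ n * Q ^ (j * (j - 1)) * q_compositions Q n j / P j"
    and "0 < k"
  shows "weight_sum True (2 * (n + k)) (2 * k) = t ^ (n + k) * Q ^ (k * k) * q_compositions Q (n + k) k / P k"
proof -
  have "weight_sum True (2 * (n + k)) (2 * k) = t ^ ((2 * k choose 2) + 2 * k) *
      (\<Sum>j\<le>k. weight_sum False (2 * n) (2 * j) / P ((2 * k - 2 * j) div 2))"
    using weight_sum_recursion[of "2 * k" True "2 * n"] \<open>0 < k\<close>
    by (simp only: sum_parity_classes) simp
  also have "t ^ ((2 * k choose 2) + 2 * k) = t ^ k * Q ^ (k * k)"
    by (rule t_power, unfold choose_two_even, cases k) auto
  also have "(\<Sum>j\<le>k. weight_sum False (2 * n) (2 * j) / P ((2 * k - 2 * j) div 2))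
      = (\<Sum>j\<le>k. t ^ n / P k * (Q ^ (j * (j - 1)) * q_binom Q k j * q_compositions Q n j))"
    by (intro sum.cong refl)
       (simp add: assms q_binom_conv_qpoch diff_mult_distrib2[symmetric])
  also have "\<dots> = t ^ n / P k * q_compositions Q (n + k) k"
    by (simp only: sum_distrib_left[symmetric] q_compositions_convolution add.commute)
  finally show ?thesis by (simp add: power_add mult_ac)
qed

lemma weight_sum_True_odd_step:
  assumes "\<And>j. weight_sum False (2 * n + 1) (2 * j + 1) = t ^ n * Q ^ (j * j) * q_binom Q n j / P j"
  shows "weight_sum True (2 * (n + k + 1)) (2 * k + 1)
    = t ^ (n + k + 1) * Q ^ (k * k + k) * q_compositions Q (n + k + 1) (k + 1) / P k"
proof -
  have "weight_sum True (2 * (n + k + 1)) (2 * k + 1) = t ^ ((2 * k + 1 choose 2) + (2 * k + 1)) *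
      (\<Sum>j\<le>k. weight_sum False (2 * n + 1) (2 * j + 1) / P ((2 * k + 1 - (2 * j + 1)) div 2))"
    using weight_sum_recursion[of "2 * k + 1" True "2 * n + 1"]
    by (simp only: sum_parity_classes) (simp add: add_ac)
  also have "t ^ ((2 * k + 1 choose 2) + (2 * k + 1)) = t ^ (k + 1) * Q ^ (k * k + k)"
    by (rule t_power) (simp add: choose_two_odd[simplified])
  also have "(\<Sum>j\<le>k. weight_sum False (2 * n + 1) (2 * j + 1) / P ((2 * k + 1 - (2 * j + 1)) div 2))
      = (\<Sum>j\<le>k. t ^ n / P k * (Q ^ (j * j) * q_binom Q k j * q_binom Q n j))"
    unfolding assms
    by (intro sum.cong refl)
       (simp add: q_binom_conv_qpoch[of _ k] diff_mult_distrib2[symmetric])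
  also have "\<dots> = t ^ n / P k * q_compositions Q (n + k + 1) (k + 1)"
    by (simp only: sum_distrib_left[symmetric] q_vandermonde_unshifted) (simp add: add.commute)
  finally show ?thesis by (simp add: power_add mult_ac)
qed

lemma weight_sum_False_odd_step:
  assumes "\<And>j. weight_sum True (2 * n) (2 * j) = t ^ n * Q ^ (j * j) * q_compositions Q n j / P j"
    and "\<And>j. weight_sum True (2 * n) (2 * j + 1)
      = t ^ n * Q ^ (j * j + j) * q_compositions Q n (j + 1) / P j"
  shows "weight_sum False (2 * (n + k) + 1) (2 * k + 1) = t ^ (n + k) * Q ^ (k * k) * q_binom Q (n + k) k / P k"
proof -
  have "weight_sum False (2 * (n + k) + 1) (2 * k + 1) = t ^ (2 * k + 1 choose 2) *
      ((\<Sum>j\<le>k. weight_sum True (2 * n) (2 * j) / P ((2 * k + 1 - 2 * j) div 2)) +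
       (\<Sum>j\<le>k. weight_sum True (2 * n) (2 * j + 1) / P ((2 * k + 1 - (2 * j + 1)) div 2)))"
    using weight_sum_recursion[of "2 * k + 1" False "2 * n"]
    by (simp only: sum_parity_classes) (simp add: add_ac)
  also have "t ^ (2 * k + 1 choose 2) = t ^ k * Q ^ (k * k)"
    by (rule t_power) (simp only: choose_two_odd)
  also have "(\<Sum>j\<le>k. weight_sum True (2 * n) (2 * j) / P ((2 * k + 1 - 2 * j) div 2)) +
       (\<Sum>j\<le>k. weight_sum True (2 * n) (2 * j + 1) / P ((2 * k + 1 - (2 * j + 1)) div 2))
      = (\<Sum>j\<le>k. t ^ n / P k * (Q ^ (j * j) * q_binom Q k j * q_binom Q n j))"
    unfolding sum.distrib[symmetric]
  proof (rule sum.cong[OF refl])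
    fix j assume "j \<in> {..k}"
    then have "(2 * k + 1 - 2 * j) div 2 = k - j" "(2 * k + 1 - (2 * j + 1)) div 2 = k - j"
      by auto
    with \<open>j \<in> {..k}\<close> show "weight_sum True (2 * n) (2 * j) / P ((2 * k + 1 - 2 * j) div 2) +
        weight_sum True (2 * n) (2 * j + 1) / P ((2 * k + 1 - (2 * j + 1)) div 2)
        = t ^ n / P k * (Q ^ (j * j) * q_binom Q k j * q_binom Q n j)"
      by (simp only: assms q_binom_conv_q_compositions[of Q n])
         (simp add: q_binom_conv_qpoch power_add field_simps)
  qed
  also have "\<dots> = t ^ n / P k * q_binom Q (n + k) k"
    by (simp only: sum_distrib_left[symmetric] q_vandermonde_unshifted add.commute)
  finally show ?thesis by (simp add: power_add mult_ac)
qed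

text \<open>If the first two columns have lengths \<open>2k\<close> and \<open>2j+1\<close>, the number of parts
  1 is odd, and rounding half of it down costs a factor: \<open>1 / (Q)\<^bsub>k-j-1\<^esub> = (1 - Q\<^bsup>k-j\<^esup>) / (Q)\<^bsub>k-j\<^esub>\<close>. The part with 1
  merges with the even \<open>j\<close>-sum into a full Gaussian binomial, and the part with \<open>Q\<^bsup>k-j\<^esup>\<close> is
  again a Vandermonde sum.\<close>

lemma weight_sum_False_even_step:
  assumes "\<And>j. weight_sum True (2 * n) (2 * j) = t ^ n * Q ^ (j * j) * q_compositions Q n j / P j"
    and "\<And>j. weight_sum True (2 * n) (2 * j + 1)
      = t ^ n * Q ^ (j * j + j) * q_compositions Q n (j + 1) / P j"
    and "0 < k"
  shows "weight_sum False (2 * (n + k)) (2 * k)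
    = t ^ (n + k) * Q ^ (k * (k - 1)) * q_compositions Q (n + k) k / P k"
proof -
  have "weight_sum False (2 * (n + k)) (2 * k) = t ^ (2 * k choose 2) *
      ((\<Sum>j\<le>k. weight_sum True (2 * n) (2 * j) / P ((2 * k - 2 * j) div 2)) +
       (\<Sum>j<k. weight_sum True (2 * n) (2 * j + 1) / P ((2 * k - (2 * j + 1)) div 2)))"
    using weight_sum_recursion[of "2 * k" False "2 * n"] \<open>0 < k\<close>
    by (simp only: sum_parity_classes) (simp add: add_ac)
  also have "t ^ (2 * k choose 2) = t ^ k * Q ^ (k * (k - 1))"
    by (rule t_power) (simp only: choose_two_even)
  also have "(\<Sum>j<k. weight_sum True (2 * n) (2 * j + 1) / P ((2 * k - (2 * j + 1)) div 2))
    = (\<Sum>j\<le>k. weight_sum True (2 * n) (2 * j + 1) * (1 - Q ^ (k - j)) / P (k - j))"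
  proof -
    have "P ((2 * k - (2 * j + 1)) div 2) = P (k - j) / (1 - Q ^ (k - j))" if "j < k" for j
    proof -
      from that have "k - j = Suc ((2 * k - (2 * j + 1)) div 2)" by simp
      then show ?thesis
        using power_neq_1[of "k - j"] that by (simp add: P_Suc del: power_Suc)
    qed
    then show ?thesis
      by (intro sum.mono_neutral_cong_left) (auto simp: not_less)
  qed
  also have "(\<Sum>j\<le>k. weight_sum True (2 * n) (2 * j) / P ((2 * k - 2 * j) div 2)) +
       (\<Sum>j\<le>k. weight_sum True (2 * n) (2 * j + 1) * (1 - Q ^ (k - j)) / P (k - j))
      = (\<Sum>j\<le>k. t ^ n / P k * (Q ^ (j * j) * q_binom Q k j * q_binom Q n j -
          Q ^ k * (Q ^ (j * j) * q_binom Q k j * q_compositions Q n (Suc j))))"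
    unfolding sum.distrib[symmetric]
  proof (rule sum.cong[OF refl])
    fix j assume "j \<in> {..k}"
    then have "(2 * k - 2 * j) div 2 = k - j" and k: "Q ^ k = Q ^ j * Q ^ (k - j)"
      by (auto simp: power_add[symmetric])
    with \<open>j \<in> {..k}\<close> show "weight_sum True (2 * n) (2 * j) / P ((2 * k - 2 * j) div 2) +
        weight_sum True (2 * n) (2 * j + 1) * (1 - Q ^ (k - j)) / P (k - j)
        = t ^ n / P k * (Q ^ (j * j) * q_binom Q k j * q_binom Q n j -
          Q ^ k * (Q ^ (j * j) * q_binom Q k j * q_compositions Q n (Suc j)))"
      by (simp only: assms q_binom_conv_q_compositions[of Q n] k)
         (simp add: q_binom_conv_qpoch power_add field_simps)
  qed
  also have "\<dots> = t ^ n / P k * (q_binom Q (n + k) k - Q ^ k * q_compositions Q (n + k) (Suc k))"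
    by (simp only: sum_distrib_left[symmetric] sum_subtractf q_vandermonde_unshifted
        q_compositions_convolution_Suc add.commute)
  also have "\<dots> = t ^ n / P k * q_compositions Q (n + k) k"
    by (simp add: q_binom_conv_q_compositions)
  finally show ?thesis by (simp add: power_add mult_ac)
qed

text \<open>Deleting a nonempty first column reduces \<open>n\<close>, except in the last formula at \<open>k = 0\<close>, where
  \<open>2n+1\<close> falls to \<open>2n\<close>. So for each \<open>n\<close> the last formula comes after the others.\<close>

lemma weight_sum_closed:
  "(\<forall>k. weight_sum False (2 * n) (2 * k) = t ^ n * Q ^ (k * (k - 1)) * q_compositions Q n k / P k) \<and>
   (\<forall>k. weight_sum True (2 * n) (2 * k) = t ^ n * Q ^ (k * k) * q_compositions Q n k / P k) \<and>
   (\<forall>k. weight_sum True (2 * n) (2 * k + 1)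
      = t ^ n * Q ^ (k * k + k) * q_compositions Q n (k + 1) / P k) \<and>
   (\<forall>k. weight_sum False (2 * n + 1) (2 * k + 1) = t ^ n * Q ^ (k * k) * q_binom Q n k / P k)"
proof (induction n rule: less_induct)
  case (less n)
  note IH = conjunct1[OF less, THEN spec]
    conjunct1[OF conjunct2[OF less], THEN spec]
    conjunct1[OF conjunct2[OF conjunct2[OF less]], THEN spec]
    conjunct2[OF conjunct2[OF conjunct2[OF less]], THEN spec]
  have split: "k = 0 \<or> n < k \<or> (\<exists>n'<n. 0 < k \<and> n = n' + k)" for k
    by (cases "n < k"; cases k) (auto intro!: exI[of _ "n - k"])
  have 1: "weight_sum False (2 * n) (2 * k) = t ^ n * Q ^ (k * (k - 1)) * q_compositions Q n k / P k" for k
    using split[of k]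
  proof (elim disjE exE conjE)
    fix n' assume "n' < n" "0 < k" "n = n' + k"
    then show ?thesis using weight_sum_False_even_step[OF IH(2,3)] by simp
  qed (cases n; simp add: weight_sum_0 weight_sum_eq_0)+
  have 2: "weight_sum True (2 * n) (2 * k) = t ^ n * Q ^ (k * k) * q_compositions Q n k / P k" for k
    using split[of k]
  proof (elim disjE exE conjE)
    fix n' assume "n' < n" "0 < k" "n = n' + k"
    then show ?thesis using weight_sum_True_even_step[OF IH(1)] by simp
  qed (cases n; simp add: weight_sum_0 weight_sum_eq_0)+
  have 3: "weight_sum True (2 * n) (2 * k + 1)
      = t ^ n * Q ^ (k * k + k) * q_compositions Q n (k + 1) / P k" for k
  proof (cases "k < n")
    case True
    then obtain n' where n': "n = n' + k + 1" "n' < n"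
      using less_imp_Suc_add[OF True] by (auto simp: add.commute)
    show ?thesis using weight_sum_True_odd_step[OF IH(4)[OF n'(2)], of k] by (simp only: n'(1))
  qed (simp add: weight_sum_eq_0)
  have 4: "weight_sum False (2 * n + 1) (2 * k + 1) = t ^ n * Q ^ (k * k) * q_binom Q n k / P k" for k
  proof (cases "n < k")
    case True
    then show ?thesis by (simp add: weight_sum_eq_0)
  next
    case False
    show ?thesis
    proof (cases "k = 0")
      case True
      then show ?thesis using weight_sum_False_odd_step[OF 2 3, of 0] by simp
    next
      case False
      with \<open>\<not> n < k\<close> obtain n' where "n' < n" "n = n' + k"
        using split[of k] by auto
      then show ?thesis using weight_sum_False_odd_step[OF IH(2,3)] by simp
    qed
  qed
  show ?case using 1 2 3 4 by blast
qed

end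

section \<open>The sum over partitions of an odd number\<close>

text \<open>The indeterminate is not a root of unity, by comparison of degrees. Hence no \<open>(Q)\<^sub>n\<close> vanishes.\<close>

lemma X_power_neq_1:
  fixes q :: "rat poly fract"
  assumes "q = Fraction_Field.Fract [:0, 1:] 1" and "0 < n"
  shows "q ^ n \<noteq> 1"
proof
  assume "q ^ n = 1"
  moreover have "q ^ n = Fraction_Field.Fract ([:0, 1:] ^ n) 1"
    by (induction n) (simp_all add: assms(1) One_fract_def)
  ultimately have "[:0, 1:] ^ n = (1 :: rat poly)"
    by (simp add: One_fract_def eq_fract)
  from arg_cong[OF this, of degree] \<open>0 < n\<close> show False
    by (simp add: degree_power_eq)
qed

theorem mainTheorem2:
  fixes q :: "rat poly fract" and m :: nat
  assumes "q = Fraction_Field.Fract [:0, 1:] 1"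
    and "m \<ge> 1"
  shows "(\<Sum>\<mu> | \<mu> \<in> partitions_of (2 * m + 1) \<and> (\<forall>i. even i \<longrightarrow> even (count \<mu> i)).
           (1 - q powi (- int (conj_part \<mu> 1))) /
           (q powi expo \<mu> *
            (\<Prod>i=1..sum_mset \<mu>. qpoch (1 / q\<^sup>2) (1 / q\<^sup>2) (count \<mu> i div 2))))
       = 1 / (q ^ m * qpoch (1 / q\<^sup>2) (1 / q\<^sup>2) m) +
         1 / q ^ (m + 1) *
         (\<Sum>i=0..m. (- 1) powi (int i - 1) /
            (q ^ (i * (i + 1)) * qpoch (1 / q\<^sup>2) (1 / q\<^sup>2) (m - i)))"
proof -
  have "q \<noteq> 0"
    using X_power_neq_1[OF assms(1), of 1]
    by (simp add: assms(1) Zero_fract_def eq_fract)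
  define t where "t = inverse q"
  define Q where "Q = 1 / q\<^sup>2"
  interpret column_weights Q t
  proof
    fix n :: nat assume "0 < n"
    then show "Q ^ n \<noteq> 1"
      using X_power_neq_1[OF assms(1), of "2 * n"] \<open>q \<noteq> 0\<close>
      by (simp add: Q_def power_divide power_mult)
  qed (simp add: Q_def t_def power_inverse divide_inverse)
  let ?S = "{\<mu>. \<mu> \<in> partitions_of (2 * m + 1) \<and> (\<forall>i. even i \<longrightarrow> even (count \<mu> i))}"
  have mem: "\<mu> \<in> orthosymplectic False n k \<longleftrightarrow>
      \<mu> \<in> partitions_of n \<and> size \<mu> = k \<and> (\<forall>i. even i \<longrightarrow> even (count \<mu> i))" for \<mu> n k
    by (simp add: orthosymplectic_def)
  have odd_size: "\<exists>j\<le>m. size \<mu> = 2 * j + 1" if \<mu>: "\<mu> \<in> ?S" for \<mu>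
  proof -
    have p: "0 \<notin># \<mu>" "sum_mset \<mu> = 2 * m + 1" and c: "\<forall>i. even i \<longrightarrow> even (count \<mu> i)"
      using \<mu> by (simp_all add: partitions_of_def)
    from p(2) have "odd (size \<mu>)"
      by (intro odd_size_orthogonal[OF _ c]) simp
    then obtain j where "size \<mu> = 2 * j + 1" by (rule oddE)
    moreover have "size \<mu> \<le> 2 * m + 1"
      using size_le_sum_mset[OF p(1)] p(2) by simp
    ultimately show ?thesis by simp
  qed
  have S: "?S = (\<Union>j\<in>{..m}. orthosymplectic False (2 * m + 1) (2 * j + 1))"
  proof (intro equalityI subsetI)
    fix \<mu> assume \<mu>: "\<mu> \<in> ?S"
    from odd_size[OF \<mu>] obtain j where "j \<le> m" "size \<mu> = 2 * j + 1" by blast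
    with \<mu> have "j \<in> {..m}" "\<mu> \<in> orthosymplectic False (2 * m + 1) (2 * j + 1)"
      unfolding mem by simp_all
    then show "\<mu> \<in> (\<Union>j\<in>{..m}. orthosymplectic False (2 * m + 1) (2 * j + 1))"
      by (rule UN_I)
  next
    fix \<mu> assume "\<mu> \<in> (\<Union>j\<in>{..m}. orthosymplectic False (2 * m + 1) (2 * j + 1))"
    then show "\<mu> \<in> ?S" unfolding UN_iff mem by blast
  qed
  have summand: "(1 - q powi (- int (conj_part \<mu> 1))) /
           (q powi expo \<mu> * (\<Prod>i=1..sum_mset \<mu>. P (count \<mu> i div 2)))
      = (1 - t ^ (2 * j + 1)) * weight False \<mu>"
    if "\<mu> \<in> orthosymplectic False (2 * m + 1) (2 * j + 1)" for \<mu> j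
  proof -
    have "conj_part \<mu> 1 = 2 * j + 1"
      using that conj_part_1[of \<mu>] unfolding mem by (simp add: partitions_of_def)
    moreover have "q powi (- int n) = t ^ n" "q powi int n = inverse (t ^ n)" for n
      by (simp_all add: t_def power_int_minus power_inverse)
    ultimately show ?thesis
      unfolding weight_def expo_eq_col_exp by (simp only: divide_inverse inverse_mult_distrib
          inverse_inverse_eq mult.assoc)
  qed
  let ?f = "\<lambda>\<mu>. (1 - q powi (- int (conj_part \<mu> 1))) /
           (q powi expo \<mu> * (\<Prod>i=1..sum_mset \<mu>. P (count \<mu> i div 2)))"
  have "sum ?f ?S = (\<Sum>j\<le>m. sum ?f (orthosymplectic False (2 * m + 1) (2 * j + 1)))"
    unfolding S by (rule sum.UNION_disjoint) (simp_all, auto dest!: size_orthosymplectic)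
  also have "\<dots> = (\<Sum>j\<le>m. (1 - t ^ (2 * j + 1)) * weight_sum False (2 * m + 1) (2 * j + 1))"
    unfolding weight_sum_def sum_distrib_left by (intro sum.cong refl summand)
  also have "\<dots> = (\<Sum>j\<le>m. t ^ m * (Q ^ (j * j) * q_binom Q m j / P j)
      - t ^ (m + 1) * (Q ^ (j * (j + 1)) * q_binom Q m j / P j))"
  proof (intro sum.cong refl)
    fix j
    have shift: "t ^ (2 * j + 1) * Q ^ (j * j) = t * Q ^ (j * (j + 1))"
      by (simp add: Q_eq power_add power_mult)
    have "weight_sum False (2 * m + 1) (2 * j + 1) = t ^ m * Q ^ (j * j) * q_binom Q m j / P j"
      using weight_sum_closed by blast
    then have "(1 - t ^ (2 * j + 1)) * weight_sum False (2 * m + 1) (2 * j + 1)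
        = t ^ m * (Q ^ (j * j) * q_binom Q m j / P j)
        - t ^ m * ((t ^ (2 * j + 1) * Q ^ (j * j)) * q_binom Q m j / P j)"
      by (simp add: algebra_simps diff_divide_distrib del: power_Suc)
    also have "t ^ m * ((t ^ (2 * j + 1) * Q ^ (j * j)) * q_binom Q m j / P j)
        = t ^ (m + 1) * (Q ^ (j * (j + 1)) * q_binom Q m j / P j)"
      unfolding shift by (simp add: mult_ac)
    finally show "(1 - t ^ (2 * j + 1)) * weight_sum False (2 * m + 1) (2 * j + 1)
        = t ^ m * (Q ^ (j * j) * q_binom Q m j / P j)
        - t ^ (m + 1) * (Q ^ (j * (j + 1)) * q_binom Q m j / P j)" .
  qed
  also have "\<dots> = t ^ m * (1 / P m) - t ^ (m + 1) *
      (\<Sum>i\<le>m. (- 1) ^ i * Q ^ (i * (i + 1) div 2) / P (m - i))"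
    by (simp only: sum_subtractf sum_distrib_left[symmetric] partial_theta_sum
        durfee_sum[where c = 0, unfolded add_0_right])
  also have "\<dots> = 1 / (q ^ m * P m) + 1 / q ^ (m + 1) *
         (\<Sum>i=0..m. (- 1) powi (int i - 1) / (q ^ (i * (i + 1)) * P (m - i)))"
  proof -
    have "(- 1) powi (int i - 1) / (q ^ (i * (i + 1)) * P (m - i))
        = - ((- 1) ^ i * Q ^ (i * (i + 1) div 2) / P (m - i))" for i
    proof -
      have "Q ^ (i * (i + 1) div 2) = 1 / q ^ (2 * (i * (i + 1) div 2))"
        by (simp only: Q_def power_divide power_one power_mult)
      also have "2 * (i * (i + 1) div 2) = i * (i + 1)"
        by simp
      finally show ?thesis
        by (simp add: power_int_diff)
    qed
    then have "(\<Sum>i=0..m. (- 1) powi (int i - 1) / (q ^ (i * (i + 1)) * P (m - i)))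
        = - (\<Sum>i\<le>m. (- 1) ^ i * Q ^ (i * (i + 1) div 2) / P (m - i))"
      by (simp only: sum_negf atMost_atLeast0)
    moreover have "t ^ n = 1 / q ^ n" for n
      by (simp add: t_def power_inverse divide_inverse)
    ultimately show ?thesis
      by (simp only: mult_minus_right) simp
  qed
  finally show ?thesis by (simp only: Q_def)
qed

end
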